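(* Consider the staking pool formation game $\mathcal{G}=(H,M,R,F,\lambda)$ with sharing parameter $0<\lambda\le 1$. There exists a unique threshold equilibrium $c^*$ of $\mathcal{G}$ if and only if $$\lambda>\frac{M}{H+M}.$$
   Context: Setting. There is a continuum of honest agents of measure $H$ and a continuum of malicious agents of measure $M$, with $H>M>0$. Every agent has one unit of stake. Each honest agent has a cost $c\ge 0$ of running a staking pool; costs are distributed according to an atomless density $f$ with support interval $[0,T)$, $0<T\le\infty$, and cumulative distribution function $F$ (so $F$ is continuous, $F(0)=0$, $F(c)<1$ for $c<T$ and $F(c)=1$ for $c\ge T$). There is a block reward $R>0$ and a sharing parameter $\lambda$ with $0<\lambda\le 1$. Game $\mathcal{G}=(H,M,R,F,\lambda)$. Malicious agents always run pools. Each honest agent runs a pool or delegates its stake (staying idle gives payoff $0$ and ties are broken in favour of delegating). Let $P$ and $D=H-P$ be the measures of honest agents who run a pool and who delegate. Delegators spread evenly over all pools, so each pool receives delegated stake $s=\frac{D}{P+M}$, and each pool has expected reward $r=\frac{R}{P+M}$. An honest pool owner with cost $c$ gets $\lambda r-c$; a delegator gets $\frac{(1-\lambda)r}{s}=\frac{(1-\lambda)R}{D}$ (read as $0$ if $\lambda=1$, and as $+\infty$ if $\lambda<1$ and $D=0$). Threshold equilibrium. A cost level $c^*>0$ is a threshold equilibrium if, when all honest agents with cost below $c^*$ run a pool and all honest agents with cost above $c^*$ delegate (so $P=F(c^* )H$ and $D=(1-F(c^* ))H$), an agent with cost $c^*$ is indifferent between running a pool and delegating, i.e. $$\frac{(1-\lambda)R}{(1-F(c^*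 ))H}=\frac{\lambda R}{F(c^* )H+M}-c^*.$$ *)

theory Defs
  imports "HOL-Probability.Probability"
begin

definition cost_distribution :: "(real \<Rightarrow> real) \<Rightarrow> real measure" where
  "cost_distribution f = density lborel (\<lambda>c. ennreal (f c))"

text \<open>
  Having support interval \<open>[0,T)\<close> is read as: \<open>0\<close> and \<open>T\<close> are the ends of the smallest
  interval carrying all the mass. Gaps inside the interval are allowed, so densities that are
  positive on all of \<open>[0,T)\<close> are a special case.
\<close>

definition cost_density :: "(real \<Rightarrow> real) \<Rightarrow> ereal \<Rightarrow> bool" where
  "cost_density f T \<longleftrightarrow>
     f \<in> borel_measurable borel \<and> (\<forall>c. 0 \<le> f c) \<and>
     prob_space (cost_distribution f) \<and>
     (\<forall>c. 0 < cdf (cost_distribution f) c \<longleftrightarrow> 0 < c) \<and>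
     (\<forall>c. cdf (cost_distribution f) c < 1 \<longleftrightarrow> ereal c < T)"

text \<open>
  \<open>P\<close> and \<open>D\<close> are the measures of the honest agents who run a pool and who delegate. As the
  \<open>M\<close> malicious agents run pools too, there are \<open>P + M\<close> pools.
\<close>

definition pool_reward :: "real \<Rightarrow> real \<Rightarrow> real \<Rightarrow> real" where
  "pool_reward M R P = R / (P + M)"

definition pool_delegated_stake :: "real \<Rightarrow> real \<Rightarrow> real \<Rightarrow> real" where
  "pool_delegated_stake M P D = D / (P + M)"

definition owner_payoff :: "real \<Rightarrow> real \<Rightarrow> real \<Rightarrow> real \<Rightarrow> real \<Rightarrow> real" where
  "owner_payoff M R lam P c = lam * pool_reward M R P - c"

text \<open>
  The payoff is extended-real valued because a delegator facing \<open>D = 0\<close> and \<open>lam < 1\<close> gets an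
  infinite payoff; real division by zero would yield \<open>0\<close> instead.
\<close>

definition delegator_payoff :: "real \<Rightarrow> real \<Rightarrow> real \<Rightarrow> real \<Rightarrow> real \<Rightarrow> ereal" where
  "delegator_payoff M R lam P D =
     (if lam = 1 then 0
      else if D = 0 then \<infinity>
      else ereal ((1 - lam) * pool_reward M R P / pool_delegated_stake M P D))"

definition threshold_equilibrium ::
    "real \<Rightarrow> real \<Rightarrow> real \<Rightarrow> (real \<Rightarrow> real) \<Rightarrow> real \<Rightarrow> real \<Rightarrow> bool" where
  "threshold_equilibrium H M R F lam c \<longleftrightarrow>
     0 < c \<and>
     (let P = F c * H; D = (1 - F c) * H
      in delegator_payoff M R lam P D = ereal (owner_payoff M R lam P c))"

lemma threshold_equilibrium_iff:
  assumes "H > 0" "M > 0" "0 \<le> F c" "F c < 1"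
  shows "threshold_equilibrium H M R F lam c \<longleftrightarrow>
    0 < c \<and> (1 - lam) * R / ((1 - F c) * H) = lam * R / (F c * H + M) - c"
proof -
  have "F c * H + M > 0"
    using assms by (simp add: add_nonneg_pos)
  then show ?thesis
    using assms
    by (auto simp: threshold_equilibrium_def Let_def delegator_payoff_def owner_payoff_def
        pool_reward_def pool_delegated_stake_def zero_ereal_def)
qed

end

(*
  The owner's advantage over a delegator is strictly decreasing in the threshold c, so there is at
  most one equilibrium. It is positive at c = 0 exactly if lam > M / (H + M); otherwise it is
  negative at every c > 0. For existence when lam < 1, multiplying it by the mass (1 - F c) * H of
  the delegators makes it continuous for all c >= 0, even where F c = 1, and it is nonpositive at
  c = lam * R / M.
*)
theory Submission
  imports Defs
begin

text \<open>For \<open>lam = 1\<close> and \<open>F c = 1\<close> the junk value \<open>0 / 0 = 0\<close> is the intended payoff.\<close>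

definition owner_advantage ::
    "real \<Rightarrow> real \<Rightarrow> real \<Rightarrow> (real \<Rightarrow> real) \<Rightarrow> real \<Rightarrow> real \<Rightarrow> real" where
  "owner_advantage H M R F lam c =
     lam * R / (F c * H + M) - c - (1 - lam) * R / ((1 - F c) * H)"

text \<open>Where \<open>F c = 1\<close> and \<open>lam < 1\<close>, the delegator payoff is
  infinite and no equilibrium is possible, but the real quotient in \<open>owner_advantage\<close>
  collapses to 0. The disjunction excludes such false zeros.\<close>

lemma threshold_equilibrium_iff_owner_advantage:
  assumes "H > 0" "M > 0" "0 \<le> F c" "F c \<le> 1"
  shows "threshold_equilibrium H M R F lam c \<longleftrightarrow>
    0 < c \<and> (lam = 1 \<or> F c < 1) \<and> owner_advantage H M R F lam c = 0"
proof (cases "F c < 1")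
  case True
  then show ?thesis
    using threshold_equilibrium_iff[of H M F c R lam] assms
    by (auto simp: owner_advantage_def)
next
  case False
  then have "F c = 1" using assms by simp
  then show ?thesis
    by (auto simp: owner_advantage_def threshold_equilibrium_def Let_def delegator_payoff_def
        owner_payoff_def pool_reward_def zero_ereal_def)
qed

text \<open>More pools lower the reward of each, and fewer delegators raise the payoff of each.
  Strictness comes from the term \<open>- c\<close> alone, as \<open>F\<close> may be flat. The side
  condition at the larger point \<open>d\<close> keeps the delegator quotient from dropping to the
  default value 0.\<close>

lemma owner_advantage_strict_decreasing:
  assumes "H > 0" "M > 0" "R > 0" "0 < lam" "lam \<le> 1"
    and F: "0 \<le> F c" "F c \<le> F d" "lam = 1 \<or> F d < 1" and "c < d"
  shows "owner_advantage H M R F lam d < owner_advantage H M R F lam c"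
proof -
  have "lam * R / (F d * H + M) \<le> lam * R / (F c * H + M)"
    using assms by (intro divide_left_mono mult_right_mono add_right_mono mult_pos_pos
        add_nonneg_pos mult_nonneg_nonneg) auto
  moreover have "(1 - lam) * R / ((1 - F c) * H) \<le> (1 - lam) * R / ((1 - F d) * H)"
  proof (cases "lam = 1")
    case False
    then show ?thesis
      using assms by (intro divide_left_mono mult_right_mono mult_pos_pos mult_nonneg_nonneg) auto
  qed simp
  ultimately show ?thesis
    using \<open>c < d\<close> unfolding owner_advantage_def by linarith
qed

lemma owner_advantage_zero_pos_iff:
  assumes "H > 0" "M > 0" "R > 0" "F 0 = 0"
  shows "owner_advantage H M R F lam 0 > 0 \<longleftrightarrow> lam > M / (H + M)"
proof -
  have "owner_advantage H M R F lam 0 = R / (H * M) * (lam * (H + M) - M)"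
    using assms by (simp add: owner_advantage_def field_simps)
  moreover have "R / (H * M) > 0" using assms by simp
  ultimately have "owner_advantage H M R F lam 0 > 0 \<longleftrightarrow> lam * (H + M) - M > 0"
    by (metis zero_less_mult_iff less_asym)
  then show ?thesis
    using assms by (simp add: pos_divide_less_eq)
qed

lemma owner_advantage_root_exists:
  assumes "H > 0" "M > 0" "R > 0" "0 < lam" "lam \<le> 1"
    and F: "\<And>c. 0 \<le> F c" "\<And>c. F c \<le> 1" "continuous_on UNIV F" "F 0 = 0"
    and pos: "owner_advantage H M R F lam 0 > 0"
  shows "\<exists>c>0. (lam = 1 \<or> F c < 1) \<and> owner_advantage H M R F lam c = 0"
proof -
  \<comment> \<open>For \<open>lam = 1\<close> the delegator term is 0, so there is no pole to
    clear, and the factor \<open>1 - F c\<close> would add spurious zeros wherever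
    \<open>F c = 1\<close>.\<close>
  define h where "h c = (if lam = 1 then R / (F c * H + M) - c
    else (lam * R / (F c * H + M) - c) * ((1 - F c) * H) - (1 - lam) * R)" for c
  have den: "F c * H + M > 0" for c
    using F(1)[of c] assms by (simp add: add_nonneg_pos)
  have "continuous_on {0..lam * R / M} F"
    using F(3) continuous_on_subset by blast
  then have cont: "continuous_on {0..lam * R / M} h"
    unfolding h_def using den
    by (cases "lam = 1") (auto intro!: continuous_intros simp: less_imp_neq[symmetric])
  have h0: "h 0 > 0"
  proof -
    have "h 0 = (if lam = 1 then 1 else H) * owner_advantage H M R F lam 0"
      using assms by (simp add: h_def owner_advantage_def field_simps)
    then show ?thesis using pos assms by simp
  qed
  \<comment> \<open>The malicious pools alone have measure \<open>M\<close>, so an owner's share of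
    the reward is at most \<open>lam * R / M\<close>; at that cost running a pool yields no
    gain.\<close>
  have "lam * R / (F (lam * R / M) * H + M) \<le> lam * R / M"
    using assms den F(1)[of "lam * R / M"] by (intro divide_left_mono) auto
  then have "h (lam * R / M) \<le> 0"
    using assms F(2)[of "lam * R / M"]
    by (auto simp: h_def intro: order_trans[OF mult_nonpos_nonneg])
  then obtain c where c: "0 \<le> c" "h c = 0"
    using IVT2'[of h "lam * R / M" 0 0] h0 cont assms by auto
  have "c > 0" using c h0 by (cases "c = 0") auto
  \<comment> \<open>If \<open>lam < 1\<close> and \<open>F c = 1\<close>, then
    \<open>h c = - (1 - lam) * R < 0\<close>, so a zero of \<open>h\<close> cannot lie
    there.\<close>
  moreover have adm: "lam = 1 \<or> F c < 1"
    using c(2) F(2)[of c] \<open>R > 0\<close> by (cases "F c = 1") (auto simp: h_def split: if_splits)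
  moreover have "owner_advantage H M R F lam c = 0"
  proof (cases "lam = 1")
    case True
    then show ?thesis using c by (simp add: h_def owner_advantage_def)
  next
    case False
    then have "(1 - F c) * H > 0" using adm assms by simp
    then show ?thesis
      using c False by (auto simp: h_def owner_advantage_def eq_divide_eq)
  qed
  ultimately show ?thesis by blast
qed

text \<open>Separates the game from the probability theory: the cost distribution enters only
  through these properties of \<open>F\<close>.\<close>

lemma ex1_threshold_equilibrium_iff:
  assumes "H > 0" "M > 0" "R > 0" "0 < lam" "lam \<le> 1"
    and F: "mono F" "\<And>c. 0 \<le> F c" "\<And>c. F c \<le> 1" "continuous_on UNIV F" "F 0 = 0"
  shows "(\<exists>!c. threshold_equilibrium H M R F lam c) \<longleftrightarrow> lam > M / (H + M)"
proof -
  let ?E = "threshold_equilibrium H M R F lam" and ?g = "owner_advantage H M R F lam"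
  have E: "?E c \<longleftrightarrow> 0 < c \<and> (lam = 1 \<or> F c < 1) \<and> ?g c = 0" for c
    using threshold_equilibrium_iff_owner_advantage assms by blast
  have decr: "?g d < ?g c" if "c < d" "lam = 1 \<or> F d < 1" for c d
    using owner_advantage_strict_decreasing[of H M R lam F c d] assms that
    by (auto simp: monoD)
  have unique: "c = d" if "?E c" "?E d" for c d
    using that decr[of c d] decr[of d c] by (cases c d rule: linorder_cases) (auto simp: E)
  \<comment> \<open>An equilibrium is a zero of \<open>?g\<close> to the right of 0, so strict
    decrease makes \<open>?g\<close> positive at 0.\<close>
  have "?g 0 > 0" if "?E c" for c
    using that decr[of 0 c] by (auto simp: E)
  moreover have "\<exists>c. ?E c" if "?g 0 > 0"
    using owner_advantage_root_exists[of H M R lam F] assms that by (auto simp: E)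
  ultimately have "(\<exists>!c. ?E c) \<longleftrightarrow> ?g 0 > 0"
    using unique by blast
  then show ?thesis
    using owner_advantage_zero_pos_iff[of H M R F lam] assms by simp
qed

text \<open>A cdf is continuous at every point without mass, and under a density each singleton has
  mass 0 because it is Lebesgue null.\<close>

lemma isCont_cdf_cost_distribution:
  assumes "f \<in> borel_measurable borel" "prob_space (cost_distribution f)"
  shows "isCont (cdf (cost_distribution f)) c"
proof -
  interpret prob_space "cost_distribution f" by fact
  interpret real_distribution "cost_distribution f"
    by unfold_locales (simp_all add: cost_distribution_def)
  have "AE x in lborel. x \<noteq> c"
    by (rule AE_lborel_singleton)
  then have "emeasure (cost_distribution f) {c} = 0"
    using assms(1) unfolding cost_distribution_def
    by (auto simp: emeasure_density nn_integral_0_iff_AE indicator_def)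
  then show ?thesis
    by (simp add: isCont_cdf measure_def)
qed

theorem theorem1:
  fixes H M R lam :: real and f :: "real \<Rightarrow> real" and T :: ereal
  assumes "H > M" and "M > 0"
    and "R > 0"
    and "0 < lam" and "lam \<le> 1"
    and "0 < T"
    and "cost_density f T"
  shows "(\<exists>!c. threshold_equilibrium H M R (cdf (cost_distribution f)) lam c)
           \<longleftrightarrow> lam > M / (H + M)"
proof (rule ex1_threshold_equilibrium_iff)
  have f: "f \<in> borel_measurable borel" "prob_space (cost_distribution f)"
    and pos: "\<And>c. 0 < cdf (cost_distribution f) c \<longleftrightarrow> 0 < c"
    using assms(7) by (auto simp: cost_density_def)
  interpret prob_space "cost_distribution f" by fact
  interpret real_distribution "cost_distribution f"
    by unfold_locales (simp_all add: cost_distribution_def)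
  show "mono (cdf (cost_distribution f))"
    by (simp add: monoI cdf_nondecreasing)
  show "0 \<le> cdf (cost_distribution f) c" "cdf (cost_distribution f) c \<le> 1" for c
    by (simp_all add: cdf_nonneg cdf_bounded_prob)
  show "continuous_on UNIV (cdf (cost_distribution f))"
    using isCont_cdf_cost_distribution[OF f] by (simp add: continuous_at_imp_continuous_on)
  show "cdf (cost_distribution f) 0 = 0"
    using pos[of 0] cdf_nonneg[of 0] by linarith
qed (use assms in auto)

end
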